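(* For any $\epsilon>0$, there exists a directed Theta-6 graph $\vec\Theta_6(P)$ (for some finite point set $P\subset\mathbb{R}^2$ in general position) whose spanning ratio is at least $5-\epsilon$.
   Context: For points $p,q\in\mathbb{R}^2$ and a norm $\|\cdot\|$, $\|pq\|$ denotes $\|q-p\|$. $\|\cdot\|_2$ is the Euclidean norm. The hexagonal norm $\|\cdot\|_H$ is the norm whose closed unit ball is the regular hexagon with vertices $(\pm1,0)$, $(\pm\frac12,\pm\frac{\sqrt3}{2})$. A finite point set $P\subset\mathbb{R}^2$ is in general position if no two distinct points of $P$ lie on a common line of slope $-\sqrt3$, $0$ or $\sqrt3$. Cones: for $p\in\mathbb{R}^2$, the three lines through $p$ with slopes $-\sqrt3,0,\sqrt3$ divide the plane into six closed cones $C_p^i$, $i\in\mathbb{Z}_6$ (indices modulo 6), labelled counterclockwise with $C_p^0$ directly below $p$; that is, $C_p^i$ is the closed cone with apex $p$ of directions with angle in $[240^\circ+60^\circ i,\,300^\circ+60^\circ i]$. For $q\in C_p^i$, $\nabla_p^q:=\{r\in C_p^i : \|pr\|_H\le\|pq\|_H\}$ (an equilateral triangle with corner $p$ and with $q$ on the opposite side). The directed Theta-6 graph $\vec\Theta_6(P)$ of a finite point set $P$ in general position has vertex set $P$ and a directed edge from $u$ to $v$ (for distinct $u,v\in P$) exactly when the interior of $\nabla_u^v$ contains no point of $P$. Each edge $uv$ has weight $\|uv\|_2$, and $d_G(u,v)$ denotes the length (sum of weights) of a shortest directed path from $u$ to $v$ in $G$. The spanning ratio of $G$ is the least $c\ge1$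 such that $d_G(u,v)\le c\|uv\|_2$ for all vertices $u,v$ of $G$. *)

theory Defs
  imports "HOL-Analysis.Analysis" "Graph_Theory.Shortest_Path"
begin

definition hexagon :: "(real^2) set" where
  "hexagon = convex hull
     {vector [1, 0], vector [-1, 0],
      vector [1/2, sqrt 3 / 2], vector [1/2, - sqrt 3 / 2],
      vector [-1/2, sqrt 3 / 2], vector [-1/2, - sqrt 3 / 2]}"

text \<open>The norm with closed unit ball \<^term>\<open>hexagon\<close>, obtained as its Minkowski gauge.\<close>

definition hex_norm :: "real^2 \<Rightarrow> real" where
  "hex_norm x = Inf {t. 0 < t \<and> x /\<^sub>R t \<in> hexagon}"

definition line_of_slope :: "real \<Rightarrow> real \<Rightarrow> (real^2) set" where
  "line_of_slope s c = {x. x $ 2 = s * x $ 1 + c}"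

definition general_position :: "(real^2) set \<Rightarrow> bool" where
  "general_position P \<longleftrightarrow>
     (\<forall>s \<in> {- sqrt 3, 0, sqrt 3}. \<forall>c. \<forall>p \<in> P. \<forall>q \<in> P.
        p \<in> line_of_slope s c \<and> q \<in> line_of_slope s c \<longrightarrow> p = q)"

text \<open>The closed cone with apex \<open>p\<close> of directions between the angles 240 + 60 i and 300 + 60 i
  degrees. The definition is 6-periodic in \<open>i\<close>, so an integer index stands for its residue class
  modulo 6.\<close>

definition theta_cone :: "int \<Rightarrow> real^2 \<Rightarrow> (real^2) set" where
  "theta_cone i p =
     {p + r *\<^sub>R vector [cos \<phi>, sin \<phi>] | r \<phi>.
        0 \<le> r \<and> 4 * pi / 3 + of_int i * (pi / 3) \<le> \<phi> \<and> \<phi> \<le> 5 * pi / 3 + of_int i * (pi / 3)}"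

text \<open>The triangle of \<open>q\<close> seen from \<open>p\<close>, meant for \<open>q\<close> in cone \<open>i\<close> of \<open>p\<close>.\<close>

definition nabla :: "int \<Rightarrow> real^2 \<Rightarrow> real^2 \<Rightarrow> (real^2) set" where
  "nabla i p q = {r \<in> theta_cone i p. hex_norm (r - p) \<le> hex_norm (q - p)}"

text \<open>For \<open>P\<close> in general position and distinct \<open>u\<close>, \<open>v\<close> in \<open>P\<close>, exactly one of the six cones
  of \<open>u\<close> contains \<open>v\<close>, so the index \<open>i\<close> below is unique.\<close>

definition theta6 :: "(real^2) set \<Rightarrow> (real^2, (real^2) \<times> (real^2)) pre_digraph" where
  "theta6 P =
     \<lparr>verts = P,
      arcs = {(u, v). u \<in> P \<and> v \<in> P \<and> u \<noteq> v \<and>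
                (\<exists>i \<in> {0..<6}. v \<in> theta_cone i u \<and> interior (nabla i u v) \<inter> P = {})},
      tail = fst,
      head = snd\<rparr>"

lemma wf_digraph_theta6: "wf_digraph (theta6 P)"
  by unfold_locales (auto simp: theta6_def)

definition arc_length :: "(real^2, 'e) pre_digraph \<Rightarrow> 'e \<Rightarrow> real" where
  "arc_length G e = norm (head G e - tail G e)"

definition graph_dist :: "(real^2, 'e) pre_digraph \<Rightarrow> real^2 \<Rightarrow> real^2 \<Rightarrow> ereal" where
  "graph_dist G u v = wf_digraph.\<mu> G (arc_length G) u v"

definition is_spanner :: "(real^2, 'e) pre_digraph \<Rightarrow> real \<Rightarrow> bool" where
  "is_spanner G c \<longleftrightarrow>
     (\<forall>u \<in> verts G. \<forall>v \<in> verts G. graph_dist G u v \<le> ereal (c * norm (v - u)))"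

text \<open>Extended-real valued: the ratio is \<^term>\<open>\<infinity>::ereal\<close> if no bound exists. Otherwise the
  infimum is attained (lemma \<open>spanning_ratio_least\<close>).\<close>

definition spanning_ratio :: "(real^2, 'e) pre_digraph \<Rightarrow> ereal" where
  "spanning_ratio G = Inf {ereal c | c. 1 \<le> c \<and> is_spanner G c}"

lemma hex_norm_le_1_iff: "hex_norm x \<le> 1 \<longleftrightarrow> x \<in> hexagon"
proof
  let ?T = "{t. 0 < t \<and> x /\<^sub>R t \<in> hexagon}"
  have bdd: "bdd_below ?T" by (rule bdd_belowI[of _ 0]) auto
  have cvx: "convex hexagon" by (simp add: hexagon_def)
  have closed: "closed hexagon"
    unfolding hexagon_def by (intro compact_imp_closed finite_imp_compact_convex_hull) auto
  have mid: "y \<in> hexagon \<Longrightarrow> z \<in> hexagon \<Longrightarrow> y /\<^sub>R 2 + z /\<^sub>R 2 \<in> hexagon" for y z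
    using convexD[OF cvx, of y z "inverse 2" "inverse 2"] by simp
  have hull: "y \<in> hexagon" if "y \<in> {vector [1, 0], vector [-1, 0],
      vector [1/2, sqrt 3 / 2], vector [1/2, - sqrt 3 / 2],
      vector [-1/2, sqrt 3 / 2], vector [-1/2, - sqrt 3 / 2]}" for y
    using that unfolding hexagon_def by (rule hull_inc)
  have zero: "0 \<in> hexagon"
  proof -
    have "(0 :: real^2) = vector [1, 0] /\<^sub>R 2 + vector [-1, 0] /\<^sub>R 2"
      by (simp add: vec_eq_iff forall_2)
    also have "\<dots> \<in> hexagon" by (intro mid hull) simp_all
    finally show ?thesis .
  qed
  { assume "x \<in> hexagon"
    then have "1 \<in> ?T" by simp
    then show "hex_norm x \<le> 1" unfolding hex_norm_def using bdd by (rule cInf_lower)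
  }
  assume le: "hex_norm x \<le> 1"
  have ne: "?T \<noteq> {}"
  proof -
    define e where "e = (vector [1, 0] :: real^2)"
    define f where "f = (vector [0, sqrt 3 / 2] :: real^2)"
    have e: "e \<in> hexagon" "- e \<in> hexagon"
    proof -
      have "- e = vector [-1, 0]" by (simp add: e_def vec_eq_iff forall_2)
      then show "e \<in> hexagon" "- e \<in> hexagon" using hull by (simp_all add: e_def)
    qed
    have fs: "f = vector [1/2, sqrt 3 / 2] /\<^sub>R 2 + vector [-1/2, sqrt 3 / 2] /\<^sub>R 2"
      "- f = vector [1/2, - sqrt 3 / 2] /\<^sub>R 2 + vector [-1/2, - sqrt 3 / 2] /\<^sub>R 2"
      by (simp_all add: f_def vec_eq_iff forall_2)
    have f: "f \<in> hexagon" "- f \<in> hexagon"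
      by (subst fs; intro mid hull; simp)+
    have seg: "a *\<^sub>R y \<in> hexagon" if "\<bar>a\<bar> \<le> 1" "y \<in> hexagon" "- y \<in> hexagon" for a y
    proof -
      have "((1 + a) / 2) *\<^sub>R y + ((1 - a) / 2) *\<^sub>R (- y) \<in> hexagon"
        using that by (intro convexD[OF cvx]) (auto simp: field_simps)
      also have "((1 + a) / 2) *\<^sub>R y + ((1 - a) / 2) *\<^sub>R (- y) = a *\<^sub>R y"
        by (simp add: vec_eq_iff field_simps)
      finally show ?thesis .
    qed
    define t where "t = 1 + 2 * \<bar>x $ 1\<bar> + 4 * \<bar>x $ 2\<bar>"
    have t: "t > 0" unfolding t_def by linarith
    define a where "a = 2 * x $ 1 / t"
    define b where "b = 4 / sqrt 3 * x $ 2 / t"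
    have "\<bar>a\<bar> \<le> 1" using t by (simp add: a_def t_def abs_mult)
    have "4 / sqrt 3 * \<bar>x $ 2\<bar> \<le> 4 * \<bar>x $ 2\<bar>"
      by (intro mult_right_mono) (auto simp: field_simps)
    also have "\<dots> \<le> t" unfolding t_def by simp
    finally have "4 / sqrt 3 * \<bar>x $ 2\<bar> / t \<le> 1" using t by (simp only: divide_le_eq_1_pos)
    then have "\<bar>b\<bar> \<le> 1" using t by (simp add: b_def abs_mult)
    have "(a *\<^sub>R e) /\<^sub>R 2 + (b *\<^sub>R f) /\<^sub>R 2 \<in> hexagon"
      using e f seg \<open>\<bar>a\<bar> \<le> 1\<close> \<open>\<bar>b\<bar> \<le> 1\<close> by (intro mid) auto
    also have "(a *\<^sub>R e) /\<^sub>R 2 + (b *\<^sub>R f) /\<^sub>R 2 = x /\<^sub>R t"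
      using t by (simp add: a_def b_def e_def f_def vec_eq_iff forall_2 field_simps)
    finally show ?thesis using t by blast
  qed
  have "x /\<^sub>R (1 + inverse (real (Suc n))) \<in> hexagon" for n
  proof -
    have "Inf ?T < 1 + inverse (real (Suc n))" using le unfolding hex_norm_def
      by (smt (verit) inverse_positive_iff_positive of_nat_0_less_iff zero_less_Suc)
    then obtain t where t: "t > 0" "x /\<^sub>R t \<in> hexagon" "t < 1 + inverse (real (Suc n))"
      using cInf_lessD[OF ne] by blast
    define s where "s = 1 + inverse (real (Suc n))"
    have "0 \<le> t / s" "t / s \<le> 1" using t unfolding s_def[symmetric] by simp_all
    then have "(t / s) *\<^sub>R (x /\<^sub>R t) + (1 - t / s) *\<^sub>R 0 \<in> hexagon"
      using t by (intro convexD[OF cvx] zero) auto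
    also have "(t / s) *\<^sub>R (x /\<^sub>R t) + (1 - t / s) *\<^sub>R 0 = x /\<^sub>R s"
      using t(1) by (simp add: divide_simps)
    finally show ?thesis unfolding s_def .
  qed
  moreover have "(\<lambda>n. x /\<^sub>R (1 + inverse (real (Suc n)))) \<longlonglongrightarrow> x /\<^sub>R (1 + 0)"
    by (intro tendsto_intros LIMSEQ_inverse_real_of_nat) auto
  ultimately have "x /\<^sub>R (1 + 0) \<in> hexagon"
    by (rule closed_sequentially[OF closed])
  then show "x \<in> hexagon" by simp
qed

lemma spanning_ratio_least:
  assumes "spanning_ratio G = ereal c"
  shows "1 \<le> c" "is_spanner G c"
proof -
  let ?S = "{ereal c | c. 1 \<le> c \<and> is_spanner G c}"
  show "1 \<le> c"
  proof -
    have "1 \<le> spanning_ratio G" unfolding spanning_ratio_def by (rule Inf_greatest) auto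
    with assms show ?thesis by simp
  qed
  have *: "graph_dist G u v \<le> ereal ((c + inverse (real (Suc n))) * norm (v - u))"
    if uv: "u \<in> verts G" "v \<in> verts G" for u v n
  proof -
    have "Inf ?S < ereal (c + inverse (real (Suc n)))"
      using assms unfolding spanning_ratio_def by simp
    then obtain d where d: "is_spanner G d" "d < c + inverse (real (Suc n))"
      unfolding Inf_less_iff by auto
    have "graph_dist G u v \<le> ereal (d * norm (v - u))"
      using d uv by (auto simp: is_spanner_def)
    also have "\<dots> \<le> ereal ((c + inverse (real (Suc n))) * norm (v - u))"
      using d(2) by (simp add: mult_right_mono)
    finally show ?thesis .
  qed
  show "is_spanner G c" unfolding is_spanner_def
  proof (intro ballI)
    fix u v assume uv: "u \<in> verts G" "v \<in> verts G"
    have "(\<lambda>n. ereal ((c + inverse (real (Suc n))) * norm (v - u)))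
            \<longlonglongrightarrow> ereal ((c + 0) * norm (v - u))"
      by (intro tendsto_intros LIMSEQ_inverse_real_of_nat)
    then show "graph_dist G u v \<le> ereal (c * norm (v - u))"
      using *[OF uv] by (auto intro: LIMSEQ_le_const)
  qed
qed

end

theory Submission
  imports Defs
begin

text \<open>The points are listed along a path from \<open>u\<close> to \<open>v\<close>, and every point sees the points after its
  successor in one cone only, in which the successor is nearer. So no arc skips a point of the list,
  and every directed path from \<open>u\<close> to \<open>v\<close> uses all consecutive steps. Up to errors that tend to 0,
  the first three steps have the length of \<open>uv\<close> and turn about \<open>v\<close> from 240 to 300, 0 and 60 degrees.
  From there the path descends to \<open>v\<close> in a zigzag inside a thin strip, with steps alternately in
  directions 180 and 300 degrees, which takes twice the direct distance. The total is 3 + 2.\<close>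

section \<open>Hexagonal coordinates\<close>

text \<open>The coordinates are linear forms chosen so that \<open>coord i\<close> and \<open>coord (i + 2)\<close> are nonnegative
  exactly on cone \<open>i\<close>, where their sum \<open>coord (i + 1)\<close> is the hexagonal norm.\<close>

definition coord :: "int \<Rightarrow> real^2 \<Rightarrow> real" where
  "coord i x = 2 / sqrt 3 *
     (x $ 1 * sin ((5 + of_int i) * (pi / 3)) - x $ 2 * cos ((5 + of_int i) * (pi / 3)))"

text \<open>Coordinates in the basis of the unit vectors in directions 0 and 60 degrees, in which
  the hexagon has integral vertices.\<close>

definition point :: "real \<Rightarrow> real \<Rightarrow> real^2" where
  "point a b = vector [a + b / 2, sqrt 3 / 2 * b]"

lemma point_nth: "point a b $ 1 = a + b / 2" "point a b $ 2 = sqrt 3 / 2 * b"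
  by (simp_all add: point_def)

lemma ex_point: "\<exists>a b. x = point a b"
proof (intro exI)
  show "x = point (x $ 1 - x $ 2 / sqrt 3) (2 / sqrt 3 * x $ 2)"
    by (simp add: vec_eq_iff forall_2 point_nth)
qed

lemma point_diff: "point a b - point c d = point (a - c) (b - d)"
  by (simp add: vec_eq_iff forall_2 point_nth field_simps)

lemma point_scaleR: "t *\<^sub>R point a b = point (t * a) (t * b)"
  by (simp add: vec_eq_iff forall_2 point_nth field_simps)

lemma point_add: "point a b + point c d = point (a + c) (b + d)"
  by (simp add: vec_eq_iff forall_2 point_nth field_simps)

lemma norm_point: "norm (point a b) = sqrt (a\<^sup>2 + a * b + b\<^sup>2)"
proof -
  have "(a + b / 2)\<^sup>2 + (sqrt 3 / 2 * b)\<^sup>2 = a\<^sup>2 + a * b + b\<^sup>2"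
    by (simp add: power_mult_distrib power_divide power2_sum)
  then show ?thesis
    by (simp add: norm_vec_def L2_set_def sum_2 point_nth)
qed

lemma sin_cos_add_2pi:
  "sin (x + 6 * (pi / 3)) = sin x" "cos (x + 6 * (pi / 3)) = cos x"
  by (simp_all add: sin_add cos_add)

lemma coord_periodic: "coord (i + 6) x = coord i x"
proof -
  have "(5 + of_int (i + 6)) * (pi / 3) = (5 + of_int i) * (pi / 3) + 6 * (pi / 3)"
    by (simp add: algebra_simps)
  then show ?thesis by (simp only: coord_def sin_cos_add_2pi)
qed

lemma coord_antiperiodic: "coord (i + 3) x = - coord i x"
proof -
  have "(5 + of_int (i + 3)) * (pi / 3) = (5 + of_int i) * (pi / 3) + pi"
    by (simp add: algebra_simps)
  then show ?thesis
    by (simp only: coord_def sin_periodic_pi cos_periodic_pi) (simp add: algebra_simps)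
qed

lemma coord_point:
  "coord 0 (point a b) = - (a + b)" "coord 1 (point a b) = - b" "coord 2 (point a b) = a"
  "coord 3 (point a b) = a + b" "coord 4 (point a b) = b" "coord 5 (point a b) = - a"
  "coord 6 (point a b) = - (a + b)" "coord 7 (point a b) = - b"
proof -
  have s3: "sqrt 3 * (sqrt 3 * x) = 3 * x" for x :: real
    by (simp flip: mult.assoc)
  \<comment> \<open>Indices -5, -4, -3 give the angles 0, 60, 120 degrees, whose sines and cosines
    are known. Period 6 and antiperiod 3 carry the values to all other indices.\<close>
  have "coord (-5) (point a b) = - b"
    using s3 by (simp add: coord_def point_nth field_simps)
  then have 1: "coord 1 (point a b) = - b" using coord_periodic[of "-5"] by simp
  have "coord (-4) (point a b) = a"
    using s3 by (simp add: coord_def point_nth sin_60 cos_60 field_simps)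
  then have 2: "coord 2 (point a b) = a" using coord_periodic[of "-4"] by simp
  have "coord (-3) (point a b) = 2 / sqrt 3 * ((a + b / 2) * (sqrt 3 / 2) - sqrt 3 / 2 * b * (- 1 / 2))"
    using sin_120 cos_120 by (simp add: coord_def point_nth)
  also have "\<dots> = a + b" by (simp add: field_simps)
  finally have "coord (-3) (point a b) = a + b" .
  then have 3: "coord 3 (point a b) = a + b" using coord_periodic[of "-3"] by simp
  show "coord 0 (point a b) = - (a + b)" "coord 1 (point a b) = - b" "coord 2 (point a b) = a"
    "coord 3 (point a b) = a + b" "coord 4 (point a b) = b" "coord 5 (point a b) = - a"
    "coord 6 (point a b) = - (a + b)" "coord 7 (point a b) = - b"
    using 1 2 3 coord_antiperiodic[of 0 "point a b"] coord_antiperiodic[of 1 "point a b"]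
      coord_antiperiodic[of 2 "point a b"] coord_antiperiodic[of 3 "point a b"]
      coord_antiperiodic[of 4 "point a b"] by simp_all
qed

text \<open>Measured from the first ray \<theta> of the cone, a vector of length \<open>r\<close> at
  angle \<psi> has its two coordinates proportional to \<open>r * sin (pi / 3 - \<psi>)\<close> and
  \<open>r * sin \<psi>\<close>. For \<open>r > 0\<close> both are nonnegative exactly when \<psi>
  lies between 0 and 60 degrees, up to full turns.\<close>

lemma theta_cone_iff: "x \<in> theta_cone i p \<longleftrightarrow> 0 \<le> coord i (x - p) \<and> 0 \<le> coord (i + 2) (x - p)"
proof -
  define \<theta> where "\<theta> = (4 + of_int i) * (pi / 3)"
  have polar: "coord i (r *\<^sub>R vector [cos (\<theta> + \<psi>), sin (\<theta> + \<psi>)]) = 2 / sqrt 3 * (r * sin (pi / 3 - \<psi>))"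
    "coord (i + 2) (r *\<^sub>R vector [cos (\<theta> + \<psi>), sin (\<theta> + \<psi>)]) = 2 / sqrt 3 * (r * sin \<psi>)" for r \<psi>
  proof -
    have 1: "(5 + of_int i) * (pi / 3) = \<theta> + pi / 3" "(5 + of_int (i + 2)) * (pi / 3) = \<theta> + pi"
      by (simp_all add: \<theta>_def algebra_simps)
    have "sin (pi / 3 - \<psi>) = sin ((\<theta> + pi / 3) - (\<theta> + \<psi>))" by simp
    also have "\<dots> = sin (\<theta> + pi / 3) * cos (\<theta> + \<psi>) - cos (\<theta> + pi / 3) * sin (\<theta> + \<psi>)"
      by (rule sin_diff)
    finally have 2: "sin (pi / 3 - \<psi>) = \<dots>" .
    show "coord i (r *\<^sub>R vector [cos (\<theta> + \<psi>), sin (\<theta> + \<psi>)]) = 2 / sqrt 3 * (r * sin (pi / 3 - \<psi>))"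
      unfolding coord_def 1 2 by (simp add: algebra_simps)
    have "sin \<psi> = sin ((\<theta> + \<psi>) - \<theta>)" by simp
    also have "\<dots> = sin (\<theta> + \<psi>) * cos \<theta> - cos (\<theta> + \<psi>) * sin \<theta>"
      by (rule sin_diff)
    finally have 3: "sin \<psi> = \<dots>" .
    show "coord (i + 2) (r *\<^sub>R vector [cos (\<theta> + \<psi>), sin (\<theta> + \<psi>)]) = 2 / sqrt 3 * (r * sin \<psi>)"
      unfolding coord_def 1 3 by (simp add: algebra_simps)
  qed
  show ?thesis
  proof
    assume "x \<in> theta_cone i p"
    then obtain r \<phi> where r: "x = p + r *\<^sub>R vector [cos \<phi>, sin \<phi>]" "0 \<le> r"
      and \<phi>: "4 * pi / 3 + of_int i * (pi / 3) \<le> \<phi>" "\<phi> \<le> 5 * pi / 3 + of_int i * (pi / 3)"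
      unfolding theta_cone_def by blast
    define \<psi> where "\<psi> = \<phi> - \<theta>"
    have \<psi>: "0 \<le> \<psi>" "\<psi> \<le> pi / 3" using \<phi> by (simp_all add: \<psi>_def \<theta>_def algebra_simps)
    then have "0 \<le> sin \<psi>" "0 \<le> sin (pi / 3 - \<psi>)" by (intro sin_ge_zero; simp)+
    then show "0 \<le> coord i (x - p) \<and> 0 \<le> coord (i + 2) (x - p)"
      using polar[of r \<psi>] r by (simp add: \<psi>_def)
  next
    assume nonneg: "0 \<le> coord i (x - p) \<and> 0 \<le> coord (i + 2) (x - p)"
    \<comment> \<open>Rotation by -\<theta> moves the first ray of the cone to the positive real
      axis, so \<open>Arg2pi\<close> measures the angle from that ray.\<close>
    define z where "z = Complex ((x - p) $ 1) ((x - p) $ 2) * cis (- \<theta>)"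
    define r where "r = cmod z"
    define \<psi> where "\<psi> = Arg2pi z"
    have "z = r * cis \<psi>"
      unfolding r_def \<psi>_def using Arg2pi_eq[of z] by (simp add: cis_conv_exp)
    then have "z * cis \<theta> = r * cis (\<theta> + \<psi>)" by (simp add: cis_mult add.commute mult.assoc)
    moreover have "z * cis \<theta> = Complex ((x - p) $ 1) ((x - p) $ 2)"
      by (simp add: z_def mult.assoc cis_mult)
    ultimately have "Complex ((x - p) $ 1) ((x - p) $ 2) = r * cis (\<theta> + \<psi>)" by simp
    then have x: "x - p = r *\<^sub>R vector [cos (\<theta> + \<psi>), sin (\<theta> + \<psi>)]"
      by (simp add: complex_eq_iff vec_eq_iff forall_2)
    show "x \<in> theta_cone i p"
    proof (cases "r = 0")
      \<comment> \<open>At the apex the signs say nothing about the angle; radius 0 with direction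
        \<theta> serves.\<close>
      case True
      then have "x = p + 0 *\<^sub>R vector [cos \<theta>, sin \<theta>]" using x by simp
      moreover have "4 * pi / 3 + of_int i * (pi / 3) \<le> \<theta>" "\<theta> \<le> 5 * pi / 3 + of_int i * (pi / 3)"
        by (simp_all add: \<theta>_def algebra_simps)
      ultimately show ?thesis unfolding theta_cone_def by blast
    next
      case False
      then have r: "r > 0" by (simp add: r_def)
      have "0 \<le> r * sin (pi / 3 - \<psi>)" "0 \<le> r * sin \<psi>"
        using nonneg unfolding x polar by (simp_all add: zero_le_divide_iff)
      then have s: "0 \<le> sin (pi / 3 - \<psi>)" "0 \<le> sin \<psi>"
        using r by (simp_all add: zero_le_mult_iff)
      have \<psi>: "0 \<le> \<psi>" "\<psi> < 2 * pi" unfolding \<psi>_def by (simp_all add: Arg2pi_ge_0 Arg2pi_lt_2pi)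
      have "\<psi> \<le> pi" using s(2) \<psi> sin_lt_zero[of \<psi>] by force
      have "\<psi> \<le> pi / 3"
      proof (rule ccontr)
        assume "\<not> \<psi> \<le> pi / 3"
        then have "0 < sin (\<psi> - pi / 3)" using \<open>\<psi> \<le> pi\<close> by (intro sin_gt_zero) (auto simp: pi_gt_zero)
        moreover have "sin (\<psi> - pi / 3) = - sin (pi / 3 - \<psi>)" using sin_minus[of "pi / 3 - \<psi>"] by simp
        ultimately show False using s(1) by simp
      qed
      then have "4 * pi / 3 + of_int i * (pi / 3) \<le> \<theta> + \<psi>" "\<theta> + \<psi> \<le> 5 * pi / 3 + of_int i * (pi / 3)"
        using \<psi>(1) by (simp_all add: \<theta>_def algebra_simps)
      moreover have "x = p + r *\<^sub>R vector [cos (\<theta> + \<psi>), sin (\<theta> + \<psi>)]" using x by (simp add: algebra_simps)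
      ultimately show ?thesis using r unfolding theta_cone_def by fastforce
    qed
  qed
qed

section \<open>The hexagon and its gauge in lattice coordinates\<close>

lemma hexagon_vertices:
  "hexagon = convex hull {point 1 0, point (- 1) 0, point 0 1, point 1 (- 1), point (- 1) 1, point 0 (- 1)}"
proof -
  have "(vector [1, 0] :: real^2) = point 1 0" "(vector [-1, 0] :: real^2) = point (-1) 0"
    "(vector [1/2, sqrt 3/2] :: real^2) = point 0 1" "(vector [1/2, - sqrt 3/2] :: real^2) = point 1 (-1)"
    "(vector [-1/2, sqrt 3/2] :: real^2) = point (-1) 1" "(vector [-1/2, - sqrt 3/2] :: real^2) = point 0 (-1)"
    by (simp_all add: vec_eq_iff forall_2 point_nth)
  then show ?thesis unfolding hexagon_def by (simp only:)
qed

lemma linear_coord: "linear (coord i)"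
  by (rule linearI) (simp_all add: coord_def algebra_simps)

text \<open>The six half-planes \<open>coord i x \<le> 1\<close> are convex and contain the
  vertices, hence the hull. Conversely, the plane splits into six sectors between neighbouring
  vertices, and in each sector the bounds place the point in the triangle of the origin and these
  two vertices.\<close>

lemma point_in_hexagon_iff: "point a b \<in> hexagon \<longleftrightarrow> \<bar>a\<bar> \<le> 1 \<and> \<bar>b\<bar> \<le> 1 \<and> \<bar>a + b\<bar> \<le> 1"
proof
  have cvx: "convex {x. coord i x \<le> 1}" for i
    using convex_linear_vimage[OF linear_coord[of i], of "{..1}"]
    by (simp add: vimage_def)
  have le: "hexagon \<subseteq> {x. coord i x \<le> 1}" if "i \<in> {0..<6}" for i
  proof -
    have "i = 0 \<or> i = 1 \<or> i = 2 \<or> i = 3 \<or> i = 4 \<or> i = 5" using that by auto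
    then show ?thesis
      unfolding hexagon_vertices by (intro hull_minimal cvx) (auto simp: coord_point)
  qed
  assume "point a b \<in> hexagon"
  then have "coord i (point a b) \<le> 1" if "i \<in> {0..<6}" for i using le[OF that] by auto
  from this[of 0] this[of 1] this[of 2] this[of 3] this[of 4] this[of 5]
  show "\<bar>a\<bar> \<le> 1 \<and> \<bar>b\<bar> \<le> 1 \<and> \<bar>a + b\<bar> \<le> 1" by (simp add: coord_point abs_le_iff)
next
  assume bd: "\<bar>a\<bar> \<le> 1 \<and> \<bar>b\<bar> \<le> 1 \<and> \<bar>a + b\<bar> \<le> 1"
  let ?V = "{point 1 0, point (- 1) 0, point 0 1, point 1 (- 1), point (- 1) 1, point 0 (- 1)}"
  have cvx: "convex hexagon" by (simp add: hexagon_def)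
  have V: "v \<in> hexagon" if "v \<in> ?V" for v
    using that unfolding hexagon_vertices by (rule hull_inc)
  have "(1/2) *\<^sub>R point 1 0 + (1/2) *\<^sub>R point (-1) 0 \<in> hexagon"
    by (intro convexD[OF cvx] V) auto
  moreover have "(1/2) *\<^sub>R point 1 0 + (1/2) *\<^sub>R point (-1) 0 = 0"
    by (simp add: vec_eq_iff forall_2 point_nth)
  ultimately have zero: "0 \<in> hexagon" by simp
  have triangle: "\<alpha> *\<^sub>R e + \<beta> *\<^sub>R f \<in> hexagon"
    if "e \<in> ?V" "f \<in> ?V" "0 \<le> \<alpha>" "0 \<le> \<beta>" "\<alpha> + \<beta> \<le> 1" for e f \<alpha> \<beta>
  proof -
    show ?thesis
    proof (cases "\<alpha> + \<beta> = 0")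
      case True
      then have "\<alpha> = 0" "\<beta> = 0" using that by simp_all
      then show ?thesis using zero by simp
    next
      case False
      define \<gamma> where "\<gamma> = \<alpha> + \<beta>"
      have \<gamma>: "0 < \<gamma>" "\<gamma> \<le> 1" using that False by (simp_all add: \<gamma>_def)
      have "(\<alpha> / \<gamma>) *\<^sub>R e + (\<beta> / \<gamma>) *\<^sub>R f \<in> hexagon"
        using that V \<gamma> by (intro convexD[OF cvx]) (auto simp: \<gamma>_def simp flip: add_divide_distrib)
      then have "\<gamma> *\<^sub>R ((\<alpha> / \<gamma>) *\<^sub>R e + (\<beta> / \<gamma>) *\<^sub>R f) + (1 - \<gamma>) *\<^sub>R 0 \<in> hexagon"
        using zero \<gamma> convexD[OF cvx, of _ 0 \<gamma> "1 - \<gamma>"] by simp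
      then show ?thesis using \<gamma> by (simp add: scaleR_add_right)
    qed
  qed
  consider "0 \<le> a" "0 \<le> b" | "a \<le> 0" "0 \<le> a + b" | "0 \<le> b" "a + b \<le> 0"
    | "a \<le> 0" "b \<le> 0" | "0 \<le> a" "a + b \<le> 0" | "b \<le> 0" "0 \<le> a + b" by linarith
  then show "point a b \<in> hexagon"
  proof cases
    case 1 then show ?thesis using triangle[of "point 1 0" "point 0 1" a b] bd
      by (simp add: point_scaleR point_add)
  next
    case 2 then show ?thesis using triangle[of "point 0 1" "point (-1) 1" "a + b" "- a"] bd
      by (simp add: point_scaleR point_add)
  next
    case 3 then show ?thesis using triangle[of "point (-1) 1" "point (-1) 0" b "- (a + b)"] bd
      by (simp add: point_scaleR point_add)
  next
    case 4 then show ?thesis using triangle[of "point (-1) 0" "point 0 (-1)" "- a" "- b"] bd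
      by (simp add: point_scaleR point_add)
  next
    case 5 then show ?thesis using triangle[of "point 0 (-1)" "point 1 (-1)" "- (a + b)" a] bd
      by (simp add: point_scaleR point_add)
  next
    case 6 then show ?thesis using triangle[of "point 1 (-1)" "point 1 0" "- b" "a + b"] bd
      by (simp add: point_scaleR point_add)
  qed
qed

lemma hex_norm_point: "hex_norm (point a b) = max \<bar>a\<bar> (max \<bar>b\<bar> \<bar>a + b\<bar>)"
proof -
  define M where "M = max \<bar>a\<bar> (max \<bar>b\<bar> \<bar>a + b\<bar>)"
  have "point a b /\<^sub>R t \<in> hexagon \<longleftrightarrow> M \<le> t" if "0 < t" for t
  proof -
    have "point a b /\<^sub>R t = point (a / t) (b / t)" by (simp add: point_scaleR divide_inverse mult.commute)
    moreover have "\<bar>a / t + b / t\<bar> = \<bar>a + b\<bar> / t" using that by (simp flip: add_divide_distrib)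
    ultimately show ?thesis using that by (simp add: point_in_hexagon_iff M_def)
  qed
  then have "{t. 0 < t \<and> point a b /\<^sub>R t \<in> hexagon} = {t. 0 < t \<and> M \<le> t}" by blast
  \<comment> \<open>\<open>M = 0\<close> only at the origin. There the requirement
    \<open>0 < t\<close> makes the set an open ray, whose infimum is still \<open>M\<close>.\<close>
  also have "\<dots> = (if M = 0 then {0<..} else {M..})" by (auto simp: M_def)
  finally show ?thesis unfolding hex_norm_def M_def[symmetric] by simp
qed

section \<open>Cones, hexagonal distance and excluded arcs\<close>

lemma upto_6_cases:
  assumes "(i::int) \<in> {0..<6}"
  obtains "i = 0" | "i = 1" | "i = 2" | "i = 3" | "i = 4" | "i = 5"
  using assms by fastforce

lemma hex_norm_eq_coord:
  assumes "i \<in> {0..<6}" "0 \<le> coord i x" "0 \<le> coord (i + 2) x"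
  shows "hex_norm x = coord (i + 1) x"
proof -
  obtain a b where "x = point a b" using ex_point by blast
  with assms show ?thesis
    by (elim upto_6_cases) (auto simp: coord_point hex_norm_point max_def abs_if)
qed

text \<open>An arc of \<open>theta6\<close> only provides some cone index. Strict positivity keeps
  \<open>x\<close> off the boundary rays, which identifies that index with the one known from
  coordinates.\<close>

lemma cone_unique:
  assumes "i \<in> {0..<6}" "0 < coord i x" "0 < coord (i + 2) x"
    and "j \<in> {0..<6}" "0 \<le> coord j x" "0 \<le> coord (j + 2) x"
  shows "i = j"
proof -
  obtain a b where "x = point a b" using ex_point by blast
  with assms(2,3,5,6) show ?thesis
    by (rule_tac upto_6_cases[OF assms(1)]; rule_tac upto_6_cases[OF assms(4)]) (auto simp: coord_point)
qed

text \<open>The point \<open>w\<close> satisfies strict forms of the inequalities that describe the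
  triangle of \<open>v\<close> seen from \<open>u\<close>. They cut out an open subset
  \<open>T\<close> of the triangle, so \<open>w\<close> lies in its interior.\<close>

lemma blocked_arc:
  assumes "i \<in> {0..<6}" "w \<in> P"
    and w: "0 < coord i (w - u)" "0 < coord (i + 2) (w - u)"
    and v: "0 < coord i (v - u)" "0 < coord (i + 2) (v - u)"
    and closer: "coord (i + 1) (w - u) < coord (i + 1) (v - u)"
  shows "(u, v) \<notin> arcs (theta6 P)"
proof
  assume "(u, v) \<in> arcs (theta6 P)"
  then obtain j where j: "j \<in> {0..<6}" "v \<in> theta_cone j u" "interior (nabla j u v) \<inter> P = {}"
    by (auto simp: theta6_def)
  then have "i = j" using cone_unique[OF assms(1) v j(1)] by (simp add: theta_cone_iff)
  define T where "T = {x. 0 < coord i (x - u) \<and> 0 < coord (i + 2) (x - u) \<and>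
    coord (i + 1) (x - u) < coord (i + 1) (v - u)}"
  have "open T" unfolding T_def coord_def
    by (intro open_Collect_conj open_Collect_less continuous_intros)
  moreover have "T \<subseteq> nabla i u v"
    using v by (auto simp: T_def nabla_def theta_cone_iff hex_norm_eq_coord[OF assms(1)])
  ultimately have "T \<subseteq> interior (nabla i u v)" by (rule interior_maximal[rotated])
  moreover have "w \<in> T" using w closer by (simp add: T_def)
  ultimately show False using j(3) \<open>w \<in> P\<close> \<open>i = j\<close> by blast
qed

section \<open>Directed paths that must visit every point\<close>

text \<open>Induction on the walk: an arc raises the index by at most one, and an arc back only
  enlarges the part of the path still to be covered. So the walk pays for each consecutive step from
  \<open>k\<close> on.\<close>

lemma awalk_cost_ge:
  fixes p :: "nat \<Rightarrow> real^2"
  assumes inj: "inj_on p {..N}"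
    and no_skip: "\<And>k l. k + 2 \<le> l \<Longrightarrow> l \<le> N \<Longrightarrow> (p k, p l) \<notin> arcs (theta6 (p ` {..N}))"
    and "k \<le> N" "pre_digraph.awalk (theta6 (p ` {..N})) (p k) es (p N)"
  shows "(\<Sum>i=k..<N. norm (p (Suc i) - p i))
    \<le> wf_digraph.awalk_cost (arc_length (theta6 (p ` {..N}))) es"
proof -
  let ?G = "theta6 (p ` {..N})"
  interpret wf_digraph ?G by (rule wf_digraph_theta6)
  show ?thesis using assms(3,4)
  proof (induction es arbitrary: k)
    case Nil
    then have "k = N" using inj by (auto simp: awalk_Nil_iff inj_on_def)
    then show ?case by simp
  next
    case (Cons e es)
    then have e: "e \<in> arcs ?G" "tail ?G e = p k" "awalk (head ?G e) es (p N)"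
      by (auto simp: awalk_Cons_iff)
    obtain l where l: "l \<le> N" "e = (p k, p l)"
      using e(1,2) by (auto simp: theta6_def)
    have "l \<le> Suc k" using no_skip[of k l] l e(1) by (metis add_2_eq_Suc' not_less_eq_eq)
    have IH: "(\<Sum>i=l..<N. norm (p (Suc i) - p i)) \<le> awalk_cost (arc_length ?G) es"
      using e(3) l by (intro Cons.IH) (simp_all add: theta6_def)
    have len: "arc_length ?G e = norm (p l - p k)"
      using l by (simp add: arc_length_def theta6_def)
    have "(\<Sum>i=k..<N. norm (p (Suc i) - p i))
        \<le> norm (p l - p k) + (\<Sum>i=l..<N. norm (p (Suc i) - p i))"
    proof (cases "l = Suc k")
      case True
      then show ?thesis using l by (simp add: sum.atLeast_Suc_lessThan)
    next
      case False
      \<comment> \<open>For an arc back, the sum from \<open>l\<close> already contains the sum from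
        \<open>k\<close>.\<close>
      then have "{k..<N} \<subseteq> {l..<N}" using \<open>l \<le> Suc k\<close> by auto
      then have "(\<Sum>i=k..<N. norm (p (Suc i) - p i)) \<le> (\<Sum>i=l..<N. norm (p (Suc i) - p i))"
        by (intro sum_mono2) auto
      then show ?thesis by (simp add: add_increasing)
    qed
    then show ?case using IH len by simp
  qed
qed

text \<open>The pair \<open>p 0\<close>, \<open>p N\<close> suffices: their graph distance is an
  infimum over walks, each at least as long as the whole path. Dividing by the positive distance of
  the ends bounds every admissible constant.\<close>

lemma spanning_ratio_ge:
  fixes p :: "nat \<Rightarrow> real^2"
  assumes inj: "inj_on p {..N}" and "0 < N"
    and no_skip: "\<And>k l. k + 2 \<le> l \<Longrightarrow> l \<le> N \<Longrightarrow> (p k, p l) \<notin> arcs (theta6 (p ` {..N}))"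
    and c: "c * norm (p N - p 0) \<le> (\<Sum>i<N. norm (p (Suc i) - p i))"
  shows "ereal c \<le> spanning_ratio (theta6 (p ` {..N}))"
  unfolding spanning_ratio_def
proof (rule Inf_greatest, clarify)
  let ?G = "theta6 (p ` {..N})"
  interpret wf_digraph ?G by (rule wf_digraph_theta6)
  fix d assume d: "is_spanner ?G d"
  have "ereal (c * norm (p N - p 0)) \<le> graph_dist ?G (p 0) (p N)"
    unfolding graph_dist_def \<mu>_def
  proof (rule INF_greatest, clarify)
    fix es assume "awalk (p 0) es (p N)"
    from awalk_cost_ge[OF inj no_skip _ this] c
    show "ereal (c * norm (p N - p 0)) \<le> ereal (awalk_cost (arc_length ?G) es)"
      by (simp add: atLeast0LessThan)
  qed
  also have "\<dots> \<le> ereal (d * norm (p N - p 0))"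
    using d by (auto simp: is_spanner_def theta6_def)
  finally have "c * norm (p N - p 0) \<le> d * norm (p N - p 0)" by simp
  moreover have "p N \<noteq> p 0" using inj \<open>0 < N\<close> by (auto simp: inj_on_def)
  ultimately show "ereal c \<le> ereal d" by (simp add: mult_le_cancel_right)
qed

text \<open>Lines of slope \<open>- sqrt 3\<close>, \<open>0\<close> and \<open>sqrt 3\<close> are
  the level lines of \<open>a + b\<close>, \<open>b\<close> and \<open>a\<close>.\<close>

lemma general_position_point:
  fixes N :: nat
  assumes "\<And>k l. k < l \<Longrightarrow> l \<le> N \<Longrightarrow> a k \<noteq> a l \<and> b k \<noteq> b l \<and> a k + b k \<noteq> a l + b l"
  shows "general_position ((\<lambda>k. point (a k) (b k)) ` {..N})"
  unfolding general_position_def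
proof (intro ballI allI impI)
  fix s c p q
  assume s: "s \<in> {- sqrt 3, 0, sqrt 3}"
    and "p \<in> (\<lambda>k. point (a k) (b k)) ` {..N}" "q \<in> (\<lambda>k. point (a k) (b k)) ` {..N}"
    and on_line: "p \<in> line_of_slope s c \<and> q \<in> line_of_slope s c"
  then obtain k l where k: "k \<le> N" "p = point (a k) (b k)" and l: "l \<le> N" "q = point (a l) (b l)"
    by auto
  from on_line have eq: "sqrt 3 / 2 * b k - s * (a k + b k / 2) = sqrt 3 / 2 * b l - s * (a l + b l / 2)"
    by (simp add: k(2) l(2) line_of_slope_def point_nth algebra_simps)
  consider "s = - sqrt 3" | "s = 0" | "s = sqrt 3" using s by blast
  then have "a k = a l \<or> b k = b l \<or> a k + b k = a l + b l"
  proof cases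
    case 1
    then have "sqrt 3 * (a k + b k) = sqrt 3 * (a l + b l)" using eq by (simp add: algebra_simps)
    then show ?thesis by simp
  next
    case 2
    then show ?thesis using eq by simp
  next
    case 3
    then have "sqrt 3 * a k = sqrt 3 * a l" using eq by (simp add: algebra_simps)
    then show ?thesis by simp
  qed
  then have "\<not> k < l" "\<not> l < k" using assms[of k l] assms[of l k] k(1) l(1) by metis+
  then show "p = q" using k l by simp
qed

section \<open>The construction\<close>

text \<open>The strip has width \<open>t\<close> and is descended in \<open>m\<close> double steps.
  Each side drifts inwards by \<open>h\<close> per double step, and \<open>2 * m * h < t\<close>
  keeps the sides apart to the end.\<close>

locale zigzag =
  fixes m :: nat and t h :: real
  assumes t: "0 < t" "m * t = 1" and h: "0 < h" "2 * m * h < t"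
begin

text \<open>Lattice coordinates of the points. Point 0 is \<open>u\<close>, point \<open>3 + 2 * m\<close> is \<open>v\<close>, and from point 3
  on the odd points run down the right side of the strip and the even points down its left side. The
  drift \<open>h\<close> serves general position and keeps later points out of the neighbouring cones.\<close>

definition xa :: "nat \<Rightarrow> real" where
  "xa k = (if k = 0 then - t else if k = 1 then 1 + 5 * t else if k = 2 then 1 + 4 * t
     else if odd k then t - ((k - 3) div 2) * h else ((k - 2) div 2) * h)"

definition xb :: "nat \<Rightarrow> real" where
  "xb k = (if k = 0 then - 1 - 7 * t else if k = 1 then - 1 - 6 * t else if k = 2 then - t
     else if odd k then (real m - (k - 3) div 2) * (t + h)
     else (real m - (k - 4) div 2) * (t + h) - h)"

definition pt :: "nat \<Rightarrow> real^2" where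
  "pt k = point (xa k) (xb k)"

text \<open>With \<open>t\<close> neglected, these are the lattice points (0, -1), (1, -1), (1, 0),
  while \<open>v\<close> is near the origin. The multiples of \<open>t\<close> are offsets that make
  the comparisons with all later points strict.\<close>

lemma start_simps:
  "xa 0 = - t" "xa (Suc 0) = 1 + 5 * t" "xa 2 = 1 + 4 * t"
  "xb 0 = - 1 - 7 * t" "xb (Suc 0) = - 1 - 6 * t" "xb 2 = - t"
  by (simp_all add: xa_def xb_def)

text \<open>Row \<open>j\<close> consists of the right point \<open>3 + 2 * j\<close> and, for
  \<open>j < m\<close>, the left point \<open>4 + 2 * j\<close>, which is lower by \<open>h\<close>
  in the second coordinate. Consecutive rows are \<open>t + h\<close> apart in that coordinate, and
  row \<open>m\<close> is \<open>v\<close> alone.\<close>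

lemma strip_simps:
  "xa (3 + 2 * j) = t - j * h" "xb (3 + 2 * j) = (real m - j) * (t + h)"
  "xa (4 + 2 * j) = (real j + 1) * h" "xb (4 + 2 * j) = (real m - j) * (t + h) - h"
  by (simp_all add: xa_def xb_def)

lemma strip_cases:
  assumes "3 \<le> k" "k \<le> 3 + 2 * m"
  obtains (right) j where "odd k" "k = 3 + 2 * j" "j \<le> m"
  | (left) j where "even k" "k = 4 + 2 * j" "j < m"
proof (cases "odd k")
  case True
  then have "k = 3 + 2 * ((k - 3) div 2)" using assms by presburger
  then show ?thesis using right[of "(k - 3) div 2"] True assms by linarith
next
  case False
  then have "k = 4 + 2 * ((k - 4) div 2)" using assms by presburger
  then show ?thesis using left[of "(k - 4) div 2"] False assms by linarith
qed

section \<open>Steps and order of the points inside the strip\<close>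

lemma mh: "0 \<le> m * h" "2 * (m * h) < t"
  using h by simp_all

lemma mult_h_le: "j \<le> m \<Longrightarrow> real j * h \<le> m * h"
  using h by simp

text \<open>The steps are (-\<alpha>, -h) from right to left and (\<alpha>, -t) from left to right,
  with \<alpha> between \<open>t - 2 * m * h\<close> and \<open>t\<close>. Both have length at least
  \<alpha>: their squared lengths exceed \<alpha>^2 by \<alpha> h + h^2 and by t (t -
  \<alpha>).\<close>

lemma strip_step:
  assumes "3 \<le> k" "k < 3 + 2 * m"
  shows "xb (Suc k) < xb k" "xa (Suc k) + xb (Suc k) < xa k + xb k"
    "t - 2 * m * h \<le> norm (pt (Suc k) - pt k)"
proof -
  have "xb (Suc k) < xb k \<and> xa (Suc k) + xb (Suc k) < xa k + xb k \<and>
    t - 2 * m * h \<le> norm (pt (Suc k) - pt k)"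
    using assms(1) less_imp_le[OF assms(2)]
  proof (cases rule: strip_cases)
    case (right j)
    then have Suc_k: "Suc k = 4 + 2 * j" and "j + 1 \<le> m" using assms by auto
    have s: "xa k = t - j * h" "xb k = (real m - j) * (t + h)"
      "xa (Suc k) = (real j + 1) * h" "xb (Suc k) = (real m - j) * (t + h) - h"
      by (simp_all only: Suc_k strip_simps of_nat_add of_nat_1) (simp_all only: right(2) strip_simps)
    define \<alpha> where "\<alpha> = t - (2 * j + 1) * h"
    have "(2 * j + 1) * h \<le> 2 * m * h"
      using \<open>j + 1 \<le> m\<close> h by (intro mult_right_mono) linarith+
    then have \<alpha>: "t - 2 * m * h \<le> \<alpha>" by (simp add: \<alpha>_def)
    have d: "xa (Suc k) - xa k = - \<alpha>" "xb (Suc k) - xb k = - h"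
      unfolding s \<alpha>_def by (simp_all add: algebra_simps)
    have "0 < \<alpha>" using \<alpha> h by linarith
    have "\<alpha> \<le> norm (pt (Suc k) - pt k)"
      using \<open>0 < \<alpha>\<close> h by (simp add: pt_def point_diff d norm_point real_le_rsqrt)
    then show ?thesis using d \<alpha> \<open>0 < \<alpha>\<close> h by linarith
  next
    case (left j)
    then have Suc_k: "Suc k = 3 + 2 * (j + 1)" and "j + 1 \<le> m" using assms by auto
    have s: "xa k = (real j + 1) * h" "xb k = (real m - j) * (t + h) - h"
      "xa (Suc k) = t - (real j + 1) * h" "xb (Suc k) = (real m - (real j + 1)) * (t + h)"
      by (simp_all only: Suc_k strip_simps of_nat_add of_nat_1) (simp_all only: left(2) strip_simps)
    define \<alpha> where "\<alpha> = t - (2 * j + 2) * h"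
    have "(2 * j + 2) * h \<le> 2 * m * h"
      using \<open>j + 1 \<le> m\<close> h by (intro mult_right_mono) linarith+
    then have \<alpha>: "t - 2 * m * h \<le> \<alpha>" by (simp add: \<alpha>_def)
    have d: "xa (Suc k) - xa k = \<alpha>" "xb (Suc k) - xb k = - t"
      unfolding s \<alpha>_def by (simp_all add: algebra_simps)
    have "0 < \<alpha>" using \<alpha> h by linarith
    have "0 < (2 * j + 2) * h" using h by simp
    then have "\<alpha> < t" by (simp add: \<alpha>_def)
    then have "\<alpha> * t \<le> t * t" using t by (intro mult_right_mono) auto
    then have "\<alpha> \<le> norm (pt (Suc k) - pt k)"
      by (simp add: pt_def point_diff d norm_point real_le_rsqrt power2_eq_square)
    then show ?thesis using d \<alpha> \<open>0 < \<alpha>\<close> \<open>\<alpha> < t\<close> t by linarith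
  qed
  then show "xb (Suc k) < xb k" "xa (Suc k) + xb (Suc k) < xa k + xb k"
    "t - 2 * m * h \<le> norm (pt (Suc k) - pt k)" by blast+
qed

lemma strip_decreasing:
  assumes "3 \<le> k" "k < l" "l \<le> 3 + 2 * m"
  shows "xb l < xb k" "xa l + xb l < xa k + xb k"
proof -
  have "xb l < xb k \<and> xa l + xb l < xa k + xb k"
    using assms(2,3)
  proof (induction l rule: less_induct)
    case (less l)
    then obtain n where n: "l = Suc n" by (cases l) auto
    then have step: "xb l < xb n" "xa l + xb l < xa n + xb n"
      using strip_step[of n] less.prems assms(1) by auto
    show ?case
    proof (cases "n = k")
      case True then show ?thesis using step by simp
    next
      case False
      then have "xb n < xb k \<and> xa n + xb n < xa k + xb k"
        using less n by auto
      then show ?thesis using step by linarith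
    qed
  qed
  then show "xb l < xb k" "xa l + xb l < xa k + xb k" by auto
qed

text \<open>Right points move left and left points move right, and by \<open>2 * m * h < t\<close>
  every left point stays to the left of every right point.\<close>

lemma strip_narrows:
  assumes "3 \<le> k" "k < l" "l \<le> 3 + 2 * m"
  shows "odd k \<Longrightarrow> xa l < xa k" "even k \<Longrightarrow> xa k < xa l"
proof -
  have "l \<ge> 3" "k \<le> 3 + 2 * m" using assms by auto
  have lr: "(real i + 1) * h < t - real j * h" if "i < m" "j \<le> m" for i j
  proof -
    have "(real i + 1) * h \<le> m * h" using that h by (intro mult_right_mono) auto
    with mult_h_le[OF that(2)] show ?thesis using h by linarith
  qed
  show "xa l < xa k" if "odd k"
    using assms(1) \<open>k \<le> _\<close>
  proof (cases rule: strip_cases)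
    case k: (right j)
    from \<open>l \<ge> 3\<close> assms(3) show ?thesis
    proof (cases rule: strip_cases)
      case (right i)
      then have "j < i" using assms k by simp
      then show ?thesis unfolding k(2) right(2) strip_simps using h by simp
    next
      case (left i)
      then show ?thesis unfolding k(2) left(2) strip_simps using lr[of i j] k by (simp add: algebra_simps)
    qed
  qed (use that in simp)
  show "xa k < xa l" if "even k"
    using assms(1) \<open>k \<le> _\<close>
  proof (cases rule: strip_cases)
    case k: (left j)
    from \<open>l \<ge> 3\<close> assms(3) show ?thesis
    proof (cases rule: strip_cases)
      case (right i)
      then show ?thesis unfolding k(2) right(2) strip_simps using lr[of j i] k by (simp add: algebra_simps)
    next
      case (left i)
      then have "j < i" using assms k by simp
      then show ?thesis unfolding k(2) left(2) strip_simps using h by simp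
    qed
  qed (use that in simp)
qed

text \<open>Coarse bounds, read off from point 3 and \<open>v\<close> by monotonicity, through which
  points 0, 1 and 2 are compared with the whole strip at once.\<close>

lemma strip_bounds:
  assumes "3 \<le> k" "k \<le> 3 + 2 * m"
  shows "0 < xa k" "xa k \<le> t" "0 \<le> xb k" "xa k + xb k < 1 + 3 * t"
proof -
  have first: "xa 3 = t" "xb 3 = 1 + m * h"
    using strip_simps(1,2)[of 0] t by (simp_all add: distrib_left)
  have last: "xb (3 + 2 * m) = 0" "xa (3 + 2 * m) = t - m * h"
    using strip_simps(1,2)[of m] by simp_all
  show "xa k + xb k < 1 + 3 * t"
    using strip_decreasing(2)[of 3 k] assms first t mh by (cases "k = 3"; simp; linarith)
  show "xa k \<le> t"
    using strip_narrows(1)[of 3 k] assms first by (cases "k = 3") auto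
  show "0 \<le> xb k"
    using strip_decreasing(1)[of k "3 + 2 * m"] assms last by (cases "k = 3 + 2 * m") auto
  from assms show "0 < xa k"
  proof (cases rule: strip_cases)
    case (right j)
    then show ?thesis unfolding right(2) strip_simps using mult_h_le[of j] t mh by linarith
  next
    case (left j)
    then show ?thesis unfolding left(2) strip_simps using h by simp
  qed
qed

text \<open>Point 0 sees all later points strictly inside cone 2. The next two lemmas place those
  after points 1 and 2 inside cones 3 and 4.\<close>

lemma order_0:
  assumes "0 < l" "l \<le> 3 + 2 * m"
  shows "xa 0 < xa l" "xb 0 < xb l" "xa 0 + xb 0 < xa l + xb l"
  using assms strip_bounds[of l] t by (cases "l = 1"; cases "l = 2"; force simp: start_simps)+

lemma order_1:
  assumes "1 < l" "l \<le> 3 + 2 * m"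
  shows "xa l < xa 1" "xb 1 < xb l" "xa 1 + xb 1 < xa l + xb l"
  using assms strip_bounds[of l] t by (cases "l = 2"; force simp: start_simps)+

lemma order_2:
  assumes "2 < l" "l \<le> 3 + 2 * m"
  shows "xa l < xa 2" "xb 2 < xb l" "xa l + xb l < xa 2 + xb 2"
  using assms strip_bounds[of l] t by (force simp: start_simps)+

lemma coordinates_distinct:
  assumes "k < l" "l \<le> 3 + 2 * m"
  shows "xa k \<noteq> xa l \<and> xb k \<noteq> xb l \<and> xa k + xb k \<noteq> xa l + xb l"
proof -
  consider "k = 0" | "k = 1" | "k = 2" | "3 \<le> k" by linarith
  then show ?thesis
  proof cases
    case 1 then show ?thesis using order_0[of l] assms by auto
  next
    case 2 then show ?thesis using order_1[of l] assms by auto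
  next
    case 3 then show ?thesis using order_2[of l] assms by auto
  next
    case 4 then show ?thesis using strip_decreasing[of k l] strip_narrows[of k l] assms by force
  qed
qed

lemma inj_pt: "inj_on pt {..3 + 2 * m}"
proof (rule linorder_inj_onI)
  fix k l assume "k < l" "k \<in> {..3 + 2 * m}" "l \<in> {..3 + 2 * m}"
  then have "xb k \<noteq> xb l" using coordinates_distinct by simp
  then have "pt k $ 2 \<noteq> pt l $ 2" by (simp add: pt_def point_nth)
  then show "pt k \<noteq> pt l" by auto
qed auto

lemma general_position_pt: "general_position (pt ` {..3 + 2 * m})"
  unfolding pt_def by (rule general_position_point) (rule coordinates_distinct)

text \<open>Points \<open>Suc k\<close> and \<open>l\<close> lie strictly inside the same cone
  \<open>i\<close> of point \<open>k\<close>, and \<open>coord (i + 1)\<close>, the hexagonal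
  distance there, is smaller for \<open>Suc k\<close>. The cone is 2, 3, 4 for \<open>k\<close> = 0,
  1, 2 and then 5 for odd and 0 for even \<open>k\<close>.\<close>

lemma no_skip:
  assumes "k + 2 \<le> l" "l \<le> 3 + 2 * m"
  shows "(pt k, pt l) \<notin> arcs (theta6 (pt ` {..3 + 2 * m}))"
proof -
  have next_pt: "pt (Suc k) \<in> pt ` {..3 + 2 * m}" using assms by simp
  have le: "Suc k < l" "Suc k \<le> 3 + 2 * m" "k < l" using assms by auto
  consider "k = 0" | "k = 1" | "k = 2" | "3 \<le> k" by linarith
  then show ?thesis
  proof cases
    case 1
    have "xa 0 < xa l" "xb 0 < xb l" "xa 0 < xa 1" "xb 0 < xb 1" "xa 1 + xb 1 < xa l + xb l"
      using order_0[of l] order_0[of 1] order_1[of l] le assms(2) by auto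
    then show ?thesis using next_pt unfolding 1
      by (intro blocked_arc[of 2 "pt 1"]) (simp_all add: pt_def point_diff coord_point)
  next
    case 2
    have "xa l < xa 1" "xa 1 + xb 1 < xa l + xb l" "xa 2 < xa 1" "xa 1 + xb 1 < xa 2 + xb 2" "xb 2 < xb l"
      using order_1[of l] order_1[of 2] order_2[of l] le assms(2) 2 by auto
    moreover have "pt 2 \<in> pt ` {..3 + 2 * m}" by simp
    ultimately show ?thesis unfolding 2
      by (intro blocked_arc[of 3 "pt 2"]) (simp_all add: pt_def point_diff coord_point)
  next
    case 3
    have "xb 2 < xb l" "xa l + xb l < xa 2 + xb 2" "xb 2 < xb 3" "xa 3 + xb 3 < xa 2 + xb 2" "xa l < xa 3"
      using order_2[of l] order_2[of 3] strip_narrows(1)[of 3 l] le assms(2) 3 by auto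
    moreover have "pt 3 \<in> pt ` {..3 + 2 * m}" by simp
    ultimately show ?thesis unfolding 3
      by (intro blocked_arc[of 4 "pt 3"]) (simp_all add: pt_def point_diff coord_point)
  next
    case 4
    note decreasing = strip_decreasing[OF 4 le(3) assms(2)] strip_decreasing[of k "Suc k"]
      strip_decreasing[of "Suc k" l]
    show ?thesis
    proof (cases "odd k")
      case True
      have "xa l < xa k" "xb l < xb k" "xa (Suc k) < xa k" "xb (Suc k) < xb k"
        "xa l + xb l < xa (Suc k) + xb (Suc k)"
        using decreasing strip_narrows(1)[of k] True 4 le assms by auto
      then show ?thesis using next_pt
        by (intro blocked_arc[of 5 "pt (Suc k)"]) (simp_all add: pt_def point_diff coord_point)
    next
      case False
      have "xa l + xb l < xa k + xb k" "xa k < xa l" "xa (Suc k) + xb (Suc k) < xa k + xb k"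
        "xa k < xa (Suc k)" "xb l < xb (Suc k)"
        using decreasing strip_narrows(2)[of k] False 4 le assms by auto
      then show ?thesis using next_pt
        by (intro blocked_arc[of 0 "pt (Suc k)"]) (simp_all add: pt_def point_diff coord_point)
    qed
  qed
qed

section \<open>Length of the path and distance of its ends\<close>

text \<open>The first three steps have length at least 1, and each of the \<open>2 * m\<close>
  zigzag steps at least \<open>t - 2 * m * h\<close>. Since \<open>m * t = 1\<close>, these bounds
  add up to 3 + 2 - 4 m^2 h.\<close>

lemma path_length: "5 - 4 * m\<^sup>2 * h \<le> (\<Sum>k<3 + 2 * m. norm (pt (Suc k) - pt k))"
proof -
  have norm_ge_1: "1 \<le> norm (point a b)" if "1 \<le> a\<^sup>2 + a * b + b\<^sup>2" for a b
    using that by (simp add: norm_point)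
  have "1 \<le> norm (pt 1 - pt 0)"
    unfolding pt_def point_diff using t
    by (intro norm_ge_1) (simp add: start_simps power2_eq_square algebra_simps)
  moreover have "1 \<le> norm (pt 2 - pt 1)"
    unfolding pt_def point_diff using t
    by (intro norm_ge_1) (simp add: start_simps power2_eq_square algebra_simps)
  moreover have "1 \<le> norm (pt 3 - pt 2)"
  proof -
    have 3: "xa 3 = t" "xb 3 = 1 + m * h"
      using strip_simps(1,2)[of 0] t by (simp_all add: distrib_left)
    define r where "r = m * h"
    have r: "0 \<le> r" "r < t" using mh by (simp_all add: r_def)
    then have "1 \<le> (1 + r + t)\<^sup>2" by (simp add: one_le_power)
    \<comment> \<open>With A = 1 + 3t and B = 1 + r + t, the squared length is A^2 - AB + B^2 = B^2
      + A (A - B), and A - B = 2t - r.\<close>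
    moreover have "0 \<le> (1 + 3 * t) * (2 * t - r)" using r t by simp
    ultimately have "1 \<le> (- 1 - 3 * t)\<^sup>2 + (- 1 - 3 * t) * (1 + r + t) + (1 + r + t)\<^sup>2"
      by (simp add: power2_eq_square algebra_simps)
    then show ?thesis unfolding pt_def point_diff
      by (intro norm_ge_1) (simp add: start_simps 3 r_def algebra_simps)
  qed
  ultimately have first: "3 \<le> (\<Sum>k<3. norm (pt (Suc k) - pt k))"
    by (simp add: numeral_3_eq_3 numeral_2_eq_2)
  have "3 + n * (t - 2 * m * h) \<le> (\<Sum>k<3 + n. norm (pt (Suc k) - pt k))" if "n \<le> 2 * m" for n
    using that
  proof (induction n)
    case 0 then show ?case using first by simp
  next
    case (Suc n)
    have "(\<Sum>k<3 + Suc n. norm (pt (Suc k) - pt k))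
        = (\<Sum>k<3 + n. norm (pt (Suc k) - pt k)) + norm (pt (Suc (3 + n)) - pt (3 + n))"
      by (simp only: add_Suc_right sum.lessThan_Suc)
    then show ?case
      using Suc strip_step(3)[of "3 + n"] by (simp add: distrib_right del: sum.lessThan_Suc)
  qed
  from this[of "2 * m"] show ?thesis using t by (simp add: algebra_simps power2_eq_square)
qed

text \<open>The displacement is \<open>point a (1 + 7 * t)\<close> with
  \<open>0 \<le> a \<le> 2 * t\<close>, so its length is at most the sum of its two lattice
  coordinates.\<close>

lemma ends_dist: "norm (pt (3 + 2 * m) - pt 0) \<le> 1 + 9 * t"
proof -
  have last: "xb (3 + 2 * m) = 0" "xa (3 + 2 * m) = t - m * h"
    using strip_simps(1,2)[of m] by simp_all
  define a where "a = 2 * t - m * h"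
  have a: "0 \<le> a" "a \<le> 2 * t" using mh t unfolding a_def by linarith+
  have "norm (pt (3 + 2 * m) - pt 0) = sqrt (a\<^sup>2 + a * (1 + 7 * t) + (1 + 7 * t)\<^sup>2)"
    unfolding pt_def point_diff norm_point last start_simps a_def by (simp add: add.commute)
  also have "\<dots> \<le> a + (1 + 7 * t)"
    using a t by (intro real_le_lsqrt) (auto simp: power2_sum)
  finally show ?thesis using a by linarith
qed

lemma spanning_ratio_pt:
  assumes "c * (1 + 9 * t) \<le> 5 - 4 * m\<^sup>2 * h"
  shows "ereal c \<le> spanning_ratio (theta6 (pt ` {..3 + 2 * m}))"
proof (rule spanning_ratio_ge[OF inj_pt _ no_skip])
  show "c * norm (pt (3 + 2 * m) - pt 0) \<le> (\<Sum>k<3 + 2 * m. norm (pt (Suc k) - pt k))"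
  proof (cases "0 \<le> c")
    case True
    then show ?thesis using mult_left_mono[OF ends_dist True] assms path_length by linarith
  next
    \<comment> \<open>A negative \<open>c\<close>, which arises for \<epsilon> > 5, reverses the
      bound on the distance of the ends, but then the left side is at most 0.\<close>
    case False
    then have "c * norm (pt (3 + 2 * m) - pt 0) \<le> 0" by (simp add: mult_nonpos_nonneg)
    also have "\<dots> \<le> (\<Sum>k<3 + 2 * m. norm (pt (Suc k) - pt k))" by (intro sum_nonneg) simp
    finally show ?thesis .
  qed
qed auto

end

theorem lemma1:
  fixes \<epsilon> :: real
  assumes "0 < \<epsilon>"
  shows "\<exists>P :: (real^2) set.
           finite P \<and> general_position P \<and> ereal (5 - \<epsilon>) \<le> spanning_ratio (theta6 P)"
proof -
  \<comment> \<open>The constant 49 is 5 * 9 + 4: the factor \<open>1 + 9 * t\<close> costs at most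
    \<open>45 * t\<close>, and the drift costs \<open>4 * t\<close>. The bound 2 gives
    \<open>2 * t < 1\<close>, as the strip condition requires for the drift
    \<open>t ^ 3\<close>.\<close>
  obtain m :: nat where m: "max 2 (49 / \<epsilon>) < m" using reals_Archimedean2 by blast
  define t where "t = 1 / real m"
  have t_eq: "0 < t" "m * t = 1" "49 * t \<le> \<epsilon>" "2 * t < 1"
    using m assms by (auto simp: t_def field_simps)
  have mt3: "m * t ^ 3 = t\<^sup>2" "m\<^sup>2 * t ^ 3 = t"
  proof -
    have "m * t ^ 3 = (m * t) * t\<^sup>2" "m\<^sup>2 * t ^ 3 = (m * t)\<^sup>2 * t"
      by (simp_all only: power2_eq_square power3_eq_cube mult_ac of_nat_mult)
    then show "m * t ^ 3 = t\<^sup>2" "m\<^sup>2 * t ^ 3 = t" unfolding t_eq(2) by simp_all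
  qed
  have "2 * t * t < 1 * t" using t_eq by (intro mult_strict_right_mono) auto
  then have "2 * m * t ^ 3 < t" using mt3(1) by (simp add: power2_eq_square)
  \<comment> \<open>The drift \<open>h = t ^ 3\<close> makes the loss 4 m^2 h equal to
    \<open>4 * t\<close>, which vanishes as \<open>m\<close> grows.\<close>
  then interpret zigzag m t "t ^ 3"
    using t_eq by unfold_locales auto
  have "(5 - \<epsilon>) * (1 + 9 * t) \<le> 5 - 4 * t"
  proof -
    have "0 \<le> \<epsilon> * t" using t_eq assms by simp
    moreover have "(5 - \<epsilon>) * (1 + 9 * t) = 5 - \<epsilon> + 45 * t - 9 * (\<epsilon> * t)"
      by (simp add: algebra_simps)
    ultimately show ?thesis using t_eq(3) by linarith
  qed
  then have "ereal (5 - \<epsilon>) \<le> spanning_ratio (theta6 (pt ` {..3 + 2 * m}))"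
    using mt3(2) by (intro spanning_ratio_pt) simp
  then show ?thesis using general_position_pt by blast
qed

end
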